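(* Let $\mathcal{A}$ be the set of triples $(a,b,p)\in\mathbb{Z}_{>0}^{3}$ such that $2<p<a<b$, both $p$ and $a$ are prime, $\gcd(a,b)=1$, and $p\nmid b$. There is no nonzero polynomial $F\in\mathbb{C}[X_1,X_2,X_3,Y]$ such that $$F\left(a,b,p,\,g\!\left(\frac{\langle a,b\rangle}{p}\right)\right)=0$$ for every $(a,b,p)\in\mathcal{A}$.
   Context: $\mathbb{N}$ denotes the non-negative integers and $\mathbb{Z}_{>0}$ the positive integers. A numerical semigroup is a subset $S\subseteq\mathbb{N}$ containing $0$, closed under addition, with $\mathbb{N}\setminus S$ finite. For positive integers $a,b$ with $\gcd(a,b)=1$, $\langle a,b\rangle=\{xa+yb: x,y\in\mathbb{N}\}$, which is a numerical semigroup. For a numerical semigroup $S$ and $p\in\mathbb{Z}_{>0}$, the quotient is $\frac{S}{p}=\{n\in\mathbb{N}: pn\in S\}$, which is again a numerical semigroup, equal to $\mathbb{N}$ if and only if $p\in S$. For a numerical semigroup $S\neq\mathbb{N}$, the Frobenius number is $g(S)=\max(\mathbb{N}\setminus S)$. *)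

theory Defs
  imports Complex_Main "HOL-Number_Theory.Number_Theory"
    "HOL-Library.Poly_Mapping" "HOL-Library.Product_Plus"
begin

definition numerical_semigroup :: "nat set \<Rightarrow> bool" where
  "numerical_semigroup S \<longleftrightarrow>
     0 \<in> S \<and> (\<forall>m\<in>S. \<forall>n\<in>S. m + n \<in> S) \<and> finite (UNIV - S)"

definition two_gen :: "nat \<Rightarrow> nat \<Rightarrow> nat set" where
  "two_gen a b = {x * a + y * b | x y. True}"

definition sg_quotient :: "nat set \<Rightarrow> nat \<Rightarrow> nat set" where
  "sg_quotient S p = {n. p * n \<in> S}"

(* Meaningful only for a numerical semigroup S other than UNIV, where UNIV - S is
   finite and nonempty. *)
definition frobenius :: "nat set \<Rightarrow> nat" where
  "frobenius S = Max (UNIV - S)"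

definition triples :: "(nat \<times> nat \<times> nat) set" where
  "triples = {(a, b, p). 2 < p \<and> p < a \<and> a < b \<and> prime p \<and> prime a \<and>
                         coprime a b \<and> \<not> p dvd b}"

(* The monoid algebra over the complex numbers of the additive monoid nat^4: (i, j, k, l) is
   the exponent vector of the monomial X1^i X2^j X3^k Y^l.  Product_Plus supplies the addition
   of exponent vectors, so that this type carries the usual ring structure. *)
type_synonym poly4 = "(nat \<times> nat \<times> nat \<times> nat) \<Rightarrow>\<^sub>0 complex"

definition eval4 :: "poly4 \<Rightarrow> complex \<Rightarrow> complex \<Rightarrow> complex \<Rightarrow> complex \<Rightarrow> complex" where
  "eval4 F x1 x2 x3 y =
     (\<Sum>(i, j, k, l) \<in> Poly_Mapping.keys F.
        Poly_Mapping.lookup F (i, j, k, l) * x1 ^ i * x2 ^ j * x3 ^ k * y ^ l)"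

lemma two_gen_iff: "n \<in> two_gen a b \<longleftrightarrow> (\<exists>x y. n = x * a + y * b)"
  by (auto simp: two_gen_def)

lemma two_gen_large:
  assumes "coprime a b" "0 < b" "a * b \<le> n"
  shows "n \<in> two_gen a b"
proof -
  obtain u where u: "[a * u = 1] (mod b)"
    using cong_solve_coprime_nat[OF assms(1)] by auto
  define x where "x = (u * n) mod b"
  have "[a * x = a * (u * n)] (mod b)"
    unfolding x_def by (intro cong_scalar_left) (simp add: cong_def)
  also have "a * (u * n) = (a * u) * n" by (simp add: ac_simps)
  also have "[(a * u) * n = 1 * n] (mod b)"
    by (rule cong_scalar_right[OF u])
  finally have c: "[a * x = n] (mod b)" by simp
  have "x < b" using assms(2) by (simp add: x_def)
  then have "a * x \<le> a * b" by (intro mult_left_mono) auto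
  then have le: "a * x \<le> n" using assms(3) by linarith
  have "b dvd n - a * x"
    using c le cong_altdef_nat[of "a * x" n b] by (simp add: cong_sym_eq)
  then obtain y where "n - a * x = b * y" by (auto simp: dvd_def)
  then have "n = x * a + y * b" using le by (simp add: mult.commute)
  then show ?thesis by (auto simp: two_gen_iff)
qed

lemma numerical_semigroup_two_gen:
  assumes "coprime a b" "0 < b"
  shows "numerical_semigroup (two_gen a b)"
proof -
  have "UNIV - two_gen a b \<subseteq> {..<a * b}"
    using two_gen_large[OF assms] by (force simp: not_less[symmetric])
  then have "finite (UNIV - two_gen a b)" by (rule finite_subset) simp
  moreover have "0 \<in> two_gen a b" by (simp add: two_gen_iff)
  moreover have "m + n \<in> two_gen a b" if mn: "m \<in> two_gen a b" "n \<in> two_gen a b" for m n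
  proof -
    from mn obtain x y x' y' where "m = x * a + y * b" "n = x' * a + y' * b"
      by (auto simp: two_gen_iff)
    then have "m + n = (x + x') * a + (y + y') * b" by (simp add: algebra_simps)
    then show ?thesis by (auto simp: two_gen_iff)
  qed
  ultimately show ?thesis by (simp add: numerical_semigroup_def)
qed

lemma numerical_semigroup_sg_quotient:
  assumes "numerical_semigroup S" "0 < p"
  shows "numerical_semigroup (sg_quotient S p)"
proof -
  have "(\<lambda>n. p * n) ` (UNIV - sg_quotient S p) \<subseteq> UNIV - S" by (auto simp: sg_quotient_def)
  moreover have "inj_on (\<lambda>n. p * n) (UNIV - sg_quotient S p)"
    using assms(2) by (auto simp: inj_on_def)
  ultimately have "finite (UNIV - sg_quotient S p)"
    using assms(1) by (meson finite_imageD finite_subset numerical_semigroup_def)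
  then show ?thesis
    using assms(1) by (auto simp: numerical_semigroup_def sg_quotient_def distrib_left)
qed

lemma triples_sg_quotient:
  assumes "(a, b, p) \<in> triples"
  shows "numerical_semigroup (sg_quotient (two_gen a b) p)"
    and "sg_quotient (two_gen a b) p \<noteq> UNIV"
proof -
  have h: "2 < p" "p < a" "a < b" "coprime a b" using assms by (auto simp: triples_def)
  show "numerical_semigroup (sg_quotient (two_gen a b) p)"
    using h by (intro numerical_semigroup_sg_quotient numerical_semigroup_two_gen) auto
  have "p \<notin> two_gen a b"
  proof
    assume "p \<in> two_gen a b"
    then obtain x y where e: "p = x * a + y * b" by (auto simp: two_gen_iff)
    have "x = 0" using e h by (cases x) auto
    moreover have "y = 0" using e h by (cases y) auto
    ultimately show False using e h by simp
  qed
  then have "1 \<notin> sg_quotient (two_gen a b) p" by (simp add: sg_quotient_def)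
  then show "sg_quotient (two_gen a b) p \<noteq> UNIV" by blast
qed

end

theory Submission
  imports Defs "HOL-Computational_Algebra.Polynomial"
begin

text \<open>
  Fix primes \<open>2 < p < a\<close> with \<open>a \<noteq> 1\<close> modulo \<open>p\<close>. The gaps of \<open>\<langle>a, b\<rangle>\<close> are the naturals of the form
  \<open>ab - ax - by\<close> with \<open>x, y \<ge> 1\<close>. Once \<open>b > ap\<close>, the largest gap divisible by \<open>p\<close> has \<open>y = 1\<close> and the least
  \<open>x \<ge> 1\<close> for which the divisibility holds, and by a suitable choice of \<open>b\<close> modulo \<open>p\<close> that \<open>x\<close> can be any
  of \<open>1, \<dots>, p - 1\<close>. So \<open>F(a, B, p, Y)\<close> vanishes on the \<open>p - 1\<close> parallel lines
  \<open>pY = (a - 1)B - ax\<close>, hence identically as soon as \<open>p - 1\<close> exceeds the degree of \<open>F\<close> in \<open>Y\<close>.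
  Euclid's argument gives infinitely many primes \<open>a \<noteq> 1\<close> modulo \<open>p\<close>, and there are infinitely
  many \<open>p\<close>, so \<open>F = 0\<close>.
\<close>

section \<open>Gaps of two-generated semigroups and Frobenius numbers of their quotients\<close>

lemma frobenius_eqI:
  assumes "m \<notin> S" "\<And>n. m < n \<Longrightarrow> n \<in> S"
  shows "frobenius S = m"
  unfolding frobenius_def
proof (rule Max_eqI)
  show "finite (UNIV - S)"
    by (rule finite_subset[of _ "{..m}"]) (use assms in \<open>auto simp: not_less[symmetric]\<close>)
qed (use assms in \<open>auto simp: not_less[symmetric]\<close>)

text \<open>A representation \<open>m = u * a + v * b\<close> would make \<open>a\<close> divide
  \<open>(v + 1) * b\<close>, hence \<open>v + 1\<close>. Then \<open>(v + 1) * b\<close> alone is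
  at least \<open>a * b\<close>, leaving no room for \<open>a * (u + x) > 0\<close>.\<close>

lemma gap_notin_two_gen:
  assumes "coprime a b" "m + b + a * x = a * b" "0 < x" "0 < a"
  shows "m \<notin> two_gen a b"
proof
  assume "m \<in> two_gen a b"
  then obtain u v where "m = u * a + v * b" by (auto simp: two_gen_iff)
  with assms have e: "a * (u + x) + (v + 1) * b = a * b" by (simp add: algebra_simps)
  then have "a dvd (v + 1) * b"
    by (metis dvd_add_right_iff dvd_triv_left)
  then have "a dvd v + 1" using assms(1) by (simp only: coprime_dvd_mult_left_iff)
  then have "a \<le> v + 1" by (rule dvd_imp_le) simp
  then have "a * b \<le> (v + 1) * b" by (rule mult_le_mono1)
  then have "a * (u + x) = 0" using e by linarith
  then show False using assms(3,4) by simp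
qed

text \<open>Solve \<open>b * y = m\<close> modulo \<open>a\<close> with \<open>y < a\<close>. Then
  \<open>m - b * y\<close> is an integer multiple of \<open>a\<close>, and its sign decides between
  membership and the form of a gap.\<close>

lemma two_gen_cases:
  assumes "coprime a b" "0 < a"
  obtains "m \<in> two_gen a b" | x y where "0 < x" "y < a" "m + a * x = b * y"
proof -
  obtain u where u: "[b * u = 1] (mod a)"
    using cong_solve_coprime_nat[of b a] assms(1) by (auto simp: coprime_commute)
  define y where "y = (u * m) mod a"
  have "[b * y = b * (u * m)] (mod a)"
    unfolding y_def by (intro cong_scalar_left) (simp add: cong_def)
  also have "b * (u * m) = (b * u) * m" by (simp add: ac_simps)
  also have "[(b * u) * m = 1 * m] (mod a)" by (rule cong_scalar_right[OF u])
  finally have c: "[b * y = m] (mod a)" by simp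
  have ya: "y < a" using assms(2) by (simp add: y_def)
  show thesis
  proof (cases "b * y \<le> m")
    case True
    then have "a dvd m - b * y"
      using c cong_altdef_nat[of "b * y" m a] by (simp add: cong_sym_eq)
    then obtain x where "m - b * y = a * x" by (auto simp: dvd_def)
    then have "m = x * a + y * b" using True by (simp add: mult.commute)
    then show thesis using that(1) by (auto simp: two_gen_iff)
  next
    case False
    then have "a dvd b * y - m"
      using c cong_altdef_nat[of m "b * y" a] by simp
    then obtain x where "b * y - m = a * x" by (auto simp: dvd_def)
    then have "m + a * x = b * y" "0 < x" using False by (auto intro: gr0I)
    then show thesis using that(2) ya by blast
  qed
qed

text \<open>By \<open>cong\<close>, \<open>p\<close> divides the gap
  \<open>a * b - b - a * x\<close>, and the quotient of the two is the candidate. A larger gap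
  divisible by \<open>p\<close> would need a coefficient of \<open>a\<close> that is smaller than
  \<open>x\<close> yet congruent to it modulo \<open>p\<close>, which \<open>x < p\<close> rules
  out.\<close>

lemma frobenius_sg_quotient_two_gen:
  assumes "coprime a b" "coprime a p" "1 < a" "a * p < b" "0 < x" "x < p"
    and cong: "[b + a * x = a * b] (mod p)"
  shows "p * frobenius (sg_quotient (two_gen a b) p) + b + a * x = a * b"
proof -
  have ax: "a * x < b"
  proof -
    have "a * x \<le> a * p" using assms(6) by simp
    then show ?thesis using assms(4) by linarith
  qed
  have le: "b + a * x \<le> a * b"
  proof -
    have "2 * b \<le> a * b" using assms(3) by simp
    then show ?thesis using ax by linarith
  qed
  then have "p dvd a * b - (b + a * x)"
    using cong cong_altdef_nat[of "b + a * x" "a * b" p] by (simp add: cong_sym_eq)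
  then obtain m where m: "a * b - (b + a * x) = p * m" by (auto simp: dvd_def)
  then have pm: "p * m + b + a * x = a * b" using le by linarith
  have "frobenius (sg_quotient (two_gen a b) p) = m"
  proof (rule frobenius_eqI)
    show "m \<notin> sg_quotient (two_gen a b) p"
      using gap_notin_two_gen[OF assms(1) pm] assms by (simp add: sg_quotient_def)
  next
    fix n assume "m < n"
    then have less: "p * m < p * n" using assms by simp
    have "p * n \<in> two_gen a b"
    proof (cases rule: two_gen_cases[OF assms(1), of "p * n"])
      case (3 x' y)
      show ?thesis
      proof (cases "y = a - 1")
        case True
        have "b * y + b = a * b" using True assms(3) by (cases a) (auto simp: algebra_simps)
        then have eq: "p * n + b + a * x' = a * b" using 3 by linarith
        then have "a * x' < a * x" using pm less by linarith
        then have x'x: "x' < x" by simp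
        have "a * (x - x') = a * x - a * x'" by (simp add: diff_mult_distrib2)
        also have "\<dots> = p * n - p * m" using eq pm by linarith
        also have "\<dots> = p * (n - m)" by (simp add: diff_mult_distrib2)
        finally have "p dvd a * (x - x')" by simp
        then have "p dvd x - x'"
          using assms(2) by (simp add: coprime_dvd_mult_right_iff coprime_commute)
        then have "p \<le> x - x'" using x'x by (intro dvd_imp_le) auto
        then show ?thesis using assms(6) by linarith
      next
        case False
        \<comment> \<open>Here \<open>p * n\<close> is at most \<open>a * b - 2 * b\<close>, which
          is below \<open>p * m\<close> because \<open>a * x < b\<close>.\<close>
        then have "y + 2 \<le> a" using 3(2) by linarith
        then have "b * (y + 2) \<le> b * a" by (rule mult_le_mono2)
        then have "b * y + 2 * b \<le> a * b" by (simp add: algebra_simps)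
        then show ?thesis using 3 less pm ax by linarith
      qed
    qed (use assms in auto)
    then show "n \<in> sg_quotient (two_gen a b) p" by (simp add: sg_quotient_def)
  qed
  then show ?thesis using pm by simp
qed

section \<open>Primes outside the residue class 1, and triples lying on a prescribed line\<close>

lemma cong_1_if_prime_divisors_cong_1:
  fixes n p :: nat
  assumes "0 < n" "\<And>q. prime q \<Longrightarrow> q dvd n \<Longrightarrow> [q = 1] (mod p)"
  shows "[n = 1] (mod p)"
  using assms
proof (induction n rule: less_induct)
  case (less n)
  show ?case
  proof (cases "n = 1")
    case False
    then obtain q where q: "prime q" "q dvd n" using prime_factor_nat by blast
    then obtain k where k: "n = q * k" by (auto simp: dvd_def)
    have "k < n" "0 < k" using k q(1) less.prems(1) prime_gt_1_nat[of q] by auto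
    then have "[k = 1] (mod p)" using less k by (metis dvd_mult)
    then have "[q * k = 1 * 1] (mod p)" using less.prems(2) q by (intro cong_mult) auto
    then show ?thesis using k by simp
  qed simp
qed

lemma infinite_primes_not_cong_1:
  fixes p :: nat
  assumes "2 < p"
  shows "infinite {a. prime a \<and> p < a \<and> \<not> [a = 1] (mod p)}"
proof -
  have "\<exists>a>m. prime a \<and> p < a \<and> \<not> [a = 1] (mod p)" for m
  proof -
    define k where "k = max m p"
    \<comment> \<open>This \<open>n\<close> is -1 modulo \<open>p\<close>, so some prime divisor of
      it is not 1 modulo \<open>p\<close>; being coprime to \<open>fact k\<close>, \<open>n\<close>
      has only prime divisors above \<open>k\<close>.\<close>
    define n where "n = p * fact k - 1"
    have n: "n + 1 = p * fact k" using assms by (simp add: n_def)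
    have npos: "0 < n"
    proof -
      have "p * 1 \<le> p * fact k" by (intro mult_le_mono2) simp
      then show ?thesis using n assms by linarith
    qed
    have "\<not> [n = 1] (mod p)"
    proof
      assume "[n = 1] (mod p)"
      then have "[n + 1 = 1 + 1] (mod p)" by (intro cong_add) auto
      \<comment> \<open>\<open>n + 1\<close> is 0 modulo \<open>p\<close>, whereas 2 is not, because
        \<open>p > 2\<close>.\<close>
      then show False using n assms by (simp add: cong_def)
    qed
    then obtain q where q: "prime q" "q dvd n" "\<not> [q = 1] (mod p)"
      using cong_1_if_prime_divisors_cong_1[OF npos] by blast
    have "k < q"
    proof (rule ccontr)
      assume "\<not> k < q"
      then have "q dvd fact k" using q(1) by (intro dvd_fact) (auto simp: prime_gt_0_nat Suc_le_eq)
      then have "q dvd n + 1" using n by simp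
      then have "q dvd 1" using q(2) by (simp only: dvd_add_right_iff)
      then show False using q(1) by simp
    qed
    then show ?thesis using q by (auto simp: k_def)
  qed
  then show ?thesis unfolding infinite_nat_iff_unbounded by simp
qed

text \<open>Since \<open>a\<close> is not 1 modulo \<open>p\<close>, \<open>a - 1\<close> is
  invertible there, so \<open>(a - 1) * b = a * x\<close> can be solved for \<open>b\<close> modulo
  \<open>p\<close> whatever \<open>x\<close> is. This is the congruence that the Frobenius formula
  requires.\<close>

lemma infinite_triples_with_frobenius:
  assumes p: "prime p" "2 < p" "p < a" and a: "prime a" "\<not> [a = 1] (mod p)"
    and x: "0 < x" "x < p"
  shows "infinite {b. (a, b, p) \<in> triples \<and>
           p * frobenius (sg_quotient (two_gen a b) p) + b + a * x = a * b}"
proof -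
  have cop: "coprime a p" using p a by (simp add: primes_coprime)
  have "\<not> p dvd a - 1"
    using a cong_altdef_nat[of 1 a p] p by simp
  then have "coprime (a - 1) p"
    using p prime_imp_coprime[of p "a - 1"] by (simp add: coprime_commute)
  then obtain u where u: "[(a - 1) * u = 1] (mod p)"
    using cong_solve_coprime_nat[of "a - 1" p] by auto
  \<comment> \<open>The residue 1 modulo \<open>a\<close> serves only to make \<open>b\<close>
    coprime to \<open>a\<close>.\<close>
  obtain c where c: "[c = 1] (mod a)" "[c = u * (a * x)] (mod p)"
    using binary_chinese_remainder_nat[OF cop, of 1 "u * (a * x)"] by auto
  have "\<exists>b>m. (a, b, p) \<in> triples \<and>
          p * frobenius (sg_quotient (two_gen a b) p) + b + a * x = a * b" for m
  proof -
    \<comment> \<open>Multiples of \<open>a * p\<close> preserve both residues; \<open>m + 2\<close>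
      of them push \<open>b\<close> beyond \<open>m\<close> and beyond \<open>a * p\<close>.\<close>
    define b where "b = c + (m + 2) * (a * p)"
    have "b = c + a * ((m + 2) * p)" "b = c + p * ((m + 2) * a)"
      by (simp_all only: b_def ac_simps)
    then have "b mod a = c mod a" "b mod p = c mod p" by (metis mod_mult_self2)+
    with c have "[b = 1] (mod a)" "[b = u * (a * x)] (mod p)" by (simp_all add: cong_def)
    have big: "a * p < b" "m < b"
    proof -
      have "1 \<le> a * p" using p by simp
      then have "(m + 2) * 1 \<le> (m + 2) * (a * p)" by (rule mult_le_mono2)
      also have "\<dots> \<le> b" unfolding b_def by (rule le_add2)
      finally show "m < b" by simp
      have "2 * (a * p) \<le> (m + 2) * (a * p)" by (rule mult_le_mono1) simp
      also have "\<dots> \<le> b" unfolding b_def by (rule le_add2)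
      finally show "a * p < b" using \<open>1 \<le> a * p\<close> by linarith
    qed
    have "coprime b a"
      using cong_imp_coprime[OF cong_sym[OF \<open>[b = 1] (mod a)\<close>]] by simp
    then have copab: "coprime a b" by (simp add: coprime_commute)
    have "[(a - 1) * b = (a - 1) * (u * (a * x))] (mod p)"
      using \<open>[b = u * (a * x)] (mod p)\<close> by (rule cong_scalar_left)
    also have "(a - 1) * (u * (a * x)) = ((a - 1) * u) * (a * x)" by (simp add: ac_simps)
    also have "[((a - 1) * u) * (a * x) = 1 * (a * x)] (mod p)" by (rule cong_scalar_right[OF u])
    finally have ab: "[(a - 1) * b = a * x] (mod p)" by simp
    have "\<not> p dvd a * x"
      using p a x by (auto simp: prime_dvd_mult_iff dest: dvd_imp_le primes_dvd_imp_eq)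
    then have "\<not> p dvd b"
      using cong_dvd_iff[OF ab] by (auto intro: dvd_mult)
    have "a * 1 \<le> a * p" using p by (intro mult_le_mono2) auto
    then have "a < b" using big by linarith
    have "[b + (a - 1) * b = b + a * x] (mod p)" using ab by (intro cong_add) auto
    moreover have "b + (a - 1) * b = a * b" using p by (cases a) auto
    ultimately have "[b + a * x = a * b] (mod p)" by (simp add: cong_sym_eq)
    then have "p * frobenius (sg_quotient (two_gen a b) p) + b + a * x = a * b"
      using copab cop p x big by (intro frobenius_sg_quotient_two_gen) auto
    then show ?thesis
      using big p a copab \<open>\<not> p dvd b\<close> \<open>a < b\<close> by (auto simp: triples_def)
  qed
  then show ?thesis unfolding infinite_nat_iff_unbounded by simp
qed

section \<open>From many zeros of a four-variable polynomial to the zero polynomial\<close>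

lemma eval4_poly:
  "eval4 F (poly q1 t) (poly q2 t) (poly q3 t) (poly q4 t) =
     poly (\<Sum>(i, j, k, l) \<in> Poly_Mapping.keys F.
       Polynomial.smult (Poly_Mapping.lookup F (i, j, k, l)) (q1 ^ i * q2 ^ j * q3 ^ k * q4 ^ l)) t"
  by (simp add: eval4_def poly_sum case_prod_unfold mult.assoc)

text \<open>Along a polynomial curve \<open>F\<close> becomes a polynomial in \<open>t\<close>
  alone, and infinitely many roots force it to vanish. With constant curves in the other
  coordinates, this frees one variable at a time.\<close>

lemma eval4_eq_0_on_curve:
  assumes "infinite T" "\<And>t. t \<in> T \<Longrightarrow> eval4 F (poly q1 t) (poly q2 t) (poly q3 t) (poly q4 t) = 0"
  shows "eval4 F (poly q1 t) (poly q2 t) (poly q3 t) (poly q4 t) = 0"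
proof -
  obtain Q where Q: "\<And>t. eval4 F (poly q1 t) (poly q2 t) (poly q3 t) (poly q4 t) = poly Q t"
    using eval4_poly by blast
  have "infinite {t. poly Q t = 0}"
    by (rule infinite_super[OF _ assms(1)]) (use assms(2) Q in auto)
  then have "Q = 0" using poly_roots_finite by blast
  then show ?thesis by (simp add: Q)
qed

lemma eval4_eq_0_in_Y:
  assumes "\<And>i j k l. (i, j, k, l) \<in> Poly_Mapping.keys F \<Longrightarrow> l \<le> d"
    and "d < card T" "\<And>t. t \<in> T \<Longrightarrow> eval4 F x1 x2 x3 t = 0"
  shows "eval4 F x1 x2 x3 y = 0"
proof -
  define Q where "Q = (\<Sum>(i, j, k, l) \<in> Poly_Mapping.keys F.
       Polynomial.monom (Poly_Mapping.lookup F (i, j, k, l) * x1 ^ i * x2 ^ j * x3 ^ k) l)"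
  have Q: "eval4 F x1 x2 x3 t = poly Q t" for t
    by (simp add: Q_def eval4_def poly_sum poly_monom case_prod_unfold)
  have "Polynomial.degree Q \<le> d"
    unfolding Q_def
    by (rule degree_sum_le) (auto intro: order.trans[OF degree_monom_le] assms(1))
  have "Q = 0"
  proof (rule ccontr)
    assume "Q \<noteq> 0"
    then have "card {t. poly Q t = 0} \<le> Polynomial.degree Q" "finite {t. poly Q t = 0}"
      by (rule card_poly_roots_bound, rule poly_roots_finite)
    moreover have "card T \<le> card {t. poly Q t = 0}"
      using assms(3) Q calculation by (intro card_mono) auto
    ultimately show False using assms(2) \<open>Polynomial.degree Q \<le> d\<close> by linarith
  qed
  then show ?thesis by (simp add: Q)
qed

lemma keys_poly4_bounded:
  fixes F :: poly4
  obtains N where "Poly_Mapping.keys F \<subseteq> {..N} \<times> {..N} \<times> {..N} \<times> {..N}"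
proof -
  \<comment> \<open>Summing all total degrees is a crude bound, but unlike a maximum it also makes
    sense for empty support.\<close>
  define N where "N = (\<Sum>(i, j, k, l) \<in> Poly_Mapping.keys F. i + j + k + l)"
  have "i + j + k + l \<le> N" if "(i, j, k, l) \<in> Poly_Mapping.keys F" for i j k l
    using member_le_sum[OF that, of "\<lambda>(i, j, k, l). i + j + k + l"] by (simp add: N_def)
  then have "Poly_Mapping.keys F \<subseteq> {..N} \<times> {..N} \<times> {..N} \<times> {..N}" by force
  then show thesis by (rule that)
qed

lemma sum_powers_eq_0_imp_coeff_eq_0:
  fixes c :: "nat \<Rightarrow> complex"
  assumes "\<And>z. (\<Sum>i\<le>N. c i * z ^ i) = 0" "i \<le> N"
  shows "c i = 0"
  using polyfun_eq_0[of c N] assms by blast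

text \<open>Padding the support to a box turns \<open>F\<close> into nested one-variable
  polynomials, whose coefficients are shown to vanish one variable after another.\<close>

lemma eval4_eq_0_imp_eq_0:
  assumes "\<And>x1 x2 x3 y. eval4 F x1 x2 x3 y = 0"
  shows "F = 0"
proof -
  obtain N where N: "Poly_Mapping.keys F \<subseteq> {..N} \<times> {..N} \<times> {..N} \<times> {..N}"
    by (rule keys_poly4_bounded)
  define c where "c i j k l = Poly_Mapping.lookup F (i, j, k, l)" for i j k l
  have "eval4 F x1 x2 x3 y = (\<Sum>i\<le>N. (\<Sum>j\<le>N. (\<Sum>k\<le>N. (\<Sum>l\<le>N. c i j k l * y ^ l)
          * x3 ^ k) * x2 ^ j) * x1 ^ i)" for x1 x2 x3 y
  proof -
    have "eval4 F x1 x2 x3 y = (\<Sum>(i, j, k, l) \<in> {..N} \<times> {..N} \<times> {..N} \<times> {..N}.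
            c i j k l * x1 ^ i * x2 ^ j * x3 ^ k * y ^ l)"
      unfolding eval4_def c_def
      by (rule sum.mono_neutral_left[OF _ N]) (auto simp: in_keys_iff)
    also have "\<dots> = (\<Sum>i\<le>N. \<Sum>j\<le>N. \<Sum>k\<le>N. \<Sum>l\<le>N. c i j k l * x1 ^ i * x2 ^ j * x3 ^ k * y ^ l)"
      by (simp add: sum.cartesian_product[symmetric])
    finally show ?thesis by (simp add: sum_distrib_left sum_distrib_right ac_simps)
  qed
  with assms have z: "(\<Sum>i\<le>N. (\<Sum>j\<le>N. (\<Sum>k\<le>N. (\<Sum>l\<le>N. c i j k l * y ^ l)
          * x3 ^ k) * x2 ^ j) * x1 ^ i) = 0" for x1 x2 x3 y by metis
  have "c i j k l = 0" if "i \<le> N" "j \<le> N" "k \<le> N" "l \<le> N" for i j k l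
  proof -
    note coeff = sum_powers_eq_0_imp_coeff_eq_0
    have "(\<Sum>j\<le>N. (\<Sum>k\<le>N. (\<Sum>l\<le>N. c i j k l * y ^ l) * x3 ^ k) * x2 ^ j) = 0" for x2 x3 y
      by (rule coeff[OF z \<open>i \<le> N\<close>])
    then have "(\<Sum>k\<le>N. (\<Sum>l\<le>N. c i j k l * y ^ l) * x3 ^ k) = 0" for x3 y
      by (rule coeff[OF _ \<open>j \<le> N\<close>])
    then have "(\<Sum>l\<le>N. c i j k l * y ^ l) = 0" for y
      by (rule coeff[OF _ \<open>k \<le> N\<close>])
    then show ?thesis by (rule coeff[OF _ \<open>l \<le> N\<close>])
  qed
  then have "e \<notin> Poly_Mapping.keys F" for e
    using N by (cases e) (auto simp: c_def in_keys_iff)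
  then have "Poly_Mapping.keys F = {}" by blast
  then show ?thesis by simp
qed

text \<open>The second coordinate is freed first, along each line separately; then, with it fixed at
  \<open>z\<close>, the lines supply enough zeros in \<open>Y\<close>.\<close>

lemma eval4_eq_0_at_primes:
  assumes F: "\<And>a b p. (a, b, p) \<in> triples \<Longrightarrow>
      eval4 F (of_nat a) (of_nat b) (of_nat p)
        (of_nat (frobenius (sg_quotient (two_gen a b) p))) = 0"
    and deg: "\<And>i j k l. (i, j, k, l) \<in> Poly_Mapping.keys F \<Longrightarrow> l \<le> d"
    and p: "prime p" "2 < p" "d + 1 < p"
    and a: "prime a" "p < a" "\<not> [a = 1] (mod p)"
  shows "eval4 F (of_nat a) z (of_nat p) y = 0"
proof -
  \<comment> \<open>The Frobenius relation solved for the Frobenius number, as a polynomial in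
    \<open>b\<close>.\<close>
  define line :: "nat \<Rightarrow> complex poly"
    where "line x = Polynomial.smult (1 / of_nat p) [:- (of_nat a * of_nat x), of_nat a - 1:]" for x
  have "eval4 F (of_nat a) z (of_nat p) (poly (line x) z) = 0" if x: "0 < x" "x < p" for x z
  proof -
    define B where "B = {b. (a, b, p) \<in> triples \<and>
           p * frobenius (sg_quotient (two_gen a b) p) + b + a * x = a * b}"
    have "infinite B"
      unfolding B_def using p a x by (intro infinite_triples_with_frobenius) auto
    then have "infinite ((of_nat :: nat \<Rightarrow> complex) ` B)"
      by (subst finite_image_iff) (auto simp: inj_on_def)
    moreover have "eval4 F (poly [:of_nat a:] t) (poly [:0, 1:] t) (poly [:of_nat p:] t)
        (poly (line x) t) = 0" if "t \<in> of_nat ` B" for t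
    proof -
      from that obtain b where b: "t = of_nat b" "b \<in> B" by blast
      let ?g = "frobenius (sg_quotient (two_gen a b) p)"
      have "(of_nat (p * ?g + b + a * x) :: complex) = of_nat (a * b)"
        using b(2) by (simp only: B_def mem_Collect_eq)
      then have "of_nat p * of_nat ?g = (of_nat a - 1) * of_nat b - (of_nat a * of_nat x :: complex)"
        by (simp add: algebra_simps)
      moreover have "poly (line x) (of_nat b) =
          ((of_nat a - 1) * of_nat b - of_nat a * of_nat x) / of_nat p"
        by (simp add: line_def diff_divide_distrib add_divide_distrib algebra_simps)
      moreover have "(of_nat p :: complex) \<noteq> 0" using p by simp
      ultimately have "poly (line x) (of_nat b) = of_nat ?g"
        by (simp add: nonzero_divide_eq_eq mult.commute)
      then show ?thesis using F b by (simp add: B_def)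
    qed
    ultimately have "eval4 F (poly [:of_nat a:] z) (poly [:0, 1:] z) (poly [:of_nat p:] z)
        (poly (line x) z) = 0"
      by (rule eval4_eq_0_on_curve)
    then show ?thesis by simp
  qed
  then have on_lines: "eval4 F (of_nat a) z (of_nat p) t = 0"
    if "t \<in> (\<lambda>x. poly (line x) z) ` {0<..<p}" for t
    using that by (elim imageE) simp
  \<comment> \<open>The lines share a slope and have distinct intercepts \<open>- a * x / p\<close>,
    so over \<open>z\<close> they take \<open>p - 1 > d\<close> distinct values.\<close>
  have "inj_on (\<lambda>x. poly (line x) z) {0<..<p}"
    using p a by (intro inj_onI) (simp add: line_def)
  then have "d < card ((\<lambda>x. poly (line x) z) ` {0<..<p})"
    using p by (simp add: card_image)
  from deg this on_lines show ?thesis by (rule eval4_eq_0_in_Y)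
qed

theorem theorem1p2:
  shows "\<not> (\<exists>F :: poly4. F \<noteq> 0 \<and>
           (\<forall>(a, b, p) \<in> triples.
              eval4 F (of_nat a) (of_nat b) (of_nat p)
                (of_nat (frobenius (sg_quotient (two_gen a b) p))) = 0))"
proof (intro notI, elim exE conjE)
  fix F :: poly4
  assume "F \<noteq> 0" and van: "\<forall>(a, b, p) \<in> triples.
              eval4 F (of_nat a) (of_nat b) (of_nat p)
                (of_nat (frobenius (sg_quotient (two_gen a b) p))) = 0"
  obtain d where "Poly_Mapping.keys F \<subseteq> {..d} \<times> {..d} \<times> {..d} \<times> {..d}"
    by (rule keys_poly4_bounded)
  then have deg: "l \<le> d" if "(i, j, k, l) \<in> Poly_Mapping.keys F" for i j k l
    using that by auto
  \<comment> \<open>The bound on \<open>p\<close> yields both \<open>2 < p\<close> and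
    \<open>d + 1 < p\<close>. The second and fourth coordinates are already free at each admissible
    prime \<open>a\<close>, and infinitely many such \<open>a\<close> free the first.\<close>
  have fixed_p: "eval4 F x1 x2 (of_nat p) y = 0" if p: "prime p" "d + 2 < p" for x1 x2 y p
  proof -
    define A where "A = {a. prime a \<and> p < a \<and> \<not> [a = 1] (mod p)}"
    have "infinite A" unfolding A_def using p by (intro infinite_primes_not_cong_1) simp
    then have "infinite ((of_nat :: nat \<Rightarrow> complex) ` A)"
      by (subst finite_image_iff) (auto simp: inj_on_def)
    moreover have "eval4 F (poly [:0, 1:] t) (poly [:x2:] t) (poly [:of_nat p:] t) (poly [:y:] t) = 0"
      if "t \<in> of_nat ` A" for t
    proof -
      from that obtain a where a: "t = of_nat a" "a \<in> A" by blast
      have "eval4 F (of_nat a) x2 (of_nat p) y = 0"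
        by (rule eval4_eq_0_at_primes[of F d]) (use van deg p a in \<open>auto simp: A_def\<close>)
      then show ?thesis using a by simp
    qed
    ultimately have "eval4 F (poly [:0, 1:] x1) (poly [:x2:] x1) (poly [:of_nat p:] x1)
        (poly [:y:] x1) = 0"
      by (rule eval4_eq_0_on_curve)
    then show ?thesis by simp
  qed
  have "eval4 F x1 x2 x3 y = 0" for x1 x2 x3 y
  proof -
    \<comment> \<open>Discarding finitely many small primes leaves enough to free the third
      coordinate.\<close>
    define P :: "nat set" where "P = {p. prime p} - {..d + 2}"
    have "infinite P" unfolding P_def by (intro Diff_infinite_finite primes_infinite) simp
    then have "infinite ((of_nat :: nat \<Rightarrow> complex) ` P)"
      by (subst finite_image_iff) (auto simp: inj_on_def)
    moreover have "eval4 F (poly [:x1:] t) (poly [:x2:] t) (poly [:0, 1:] t) (poly [:y:] t) = 0"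
      if "t \<in> of_nat ` P" for t
    proof -
      from that obtain p where "t = of_nat p" "p \<in> P" by blast
      then show ?thesis using fixed_p[of p] by (simp add: P_def)
    qed
    ultimately have "eval4 F (poly [:x1:] x3) (poly [:x2:] x3) (poly [:0, 1:] x3)
        (poly [:y:] x3) = 0"
      by (rule eval4_eq_0_on_curve)
    then show ?thesis by simp
  qed
  then have "F = 0" by (rule eval4_eq_0_imp_eq_0)
  with \<open>F \<noteq> 0\<close> show False ..
qed

end
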